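(* There exist absolute constants $C, c>0$ and $n_0$ such that for all $n\geq n_0$ and all $k$ the following holds. Let $\mathbf{c}=(c_1,\dots,c_k)$ be any initial $k$-color configuration on $n$ nodes (with $c_1\geq c_2\geq\dots\geq c_k$) such that \[ s(\mathbf{c}) = c_1-c_2 \;\geq\; 22\sqrt{\min\left\{2k,\ \sqrt[3]{\frac{n}{\log n}}\right\}\, n\log n}. \] Then, with probability at least $1-n^{-c}$, the 3-majority protocol started from $\mathbf{c}$ reaches the configuration in which all $n$ nodes have the plurality color $1$ within at most $C\,\min\left\{2k,\ \sqrt[3]{n/\log n}\right\}\log n$ rounds.
   Context: A $k$-color configuration on $n$ nodes is a $k$-tuple $\mathbf{c}=(c_1,\dots,c_k)$ of non-negative integers with $\sum_{j} c_j = n$, where $c_j$ is the number of nodes with color $j\in[k]=\{1,\dots,k\}$. Colors are indexed so that in the initial configuration $c_1\geq c_2\geq\dots\geq c_k$; color $1$ is the plurality color and $s(\mathbf{c})=c_1-c_2$ is the bias. 3-majority protocol (on the clique, synchronous rounds): at every round, every node, independently of the others, picks three nodes uniformly at random (including itself and with repetitions) and recolors itself according to the majority of the colors it sees; if it sees three different colors, it chooses the first one. All nodes update simultaneously, using the colors at the beginning of the round. $\log$ is the natural logarithm. *)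

theory Defs
  imports "HOL-Probability.Probability" "HOL-Probability.Product_PMF"
begin

text \<open>
  The nodes of the clique are \<open>{..<n}\<close> and the colors are \<open>{1..k}\<close>. A configuration is a
  function on colors that vanishes outside \<open>{1..k}\<close>; in particular the bias of a
  one-color configuration is \<open>c 1 - 0\<close>.
\<close>

definition color_config :: "nat \<Rightarrow> nat \<Rightarrow> (nat \<Rightarrow> nat) \<Rightarrow> bool" where
  "color_config n k c \<longleftrightarrow> (\<forall>j. j \<notin> {1..k} \<longrightarrow> c j = 0) \<and> (\<Sum>j\<in>{1..k}. c j) = n"

definition colors_sorted :: "nat \<Rightarrow> (nat \<Rightarrow> nat) \<Rightarrow> bool" where
  "colors_sorted k c \<longleftrightarrow> (\<forall>i\<in>{1..k}. \<forall>j\<in>{1..k}. i \<le> j \<longrightarrow> c j \<le> c i)"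

definition bias :: "(nat \<Rightarrow> nat) \<Rightarrow> real" where
  "bias c = real (c 1) - real (c 2)"

definition config_of :: "nat \<Rightarrow> (nat \<Rightarrow> nat) \<Rightarrow> nat \<Rightarrow> nat" where
  "config_of n x j = card {v\<in>{..<n}. x v = j}"

definition majority3 :: "nat \<Rightarrow> nat \<Rightarrow> nat \<Rightarrow> nat" where
  "majority3 a b c = (if a = b \<or> a = c then a else if b = c then b else a)"

text \<open>
  One synchronous round. \<open>Pi_pmf\<close> makes the choices of the nodes independent; a uniformly
  random triple is the same as three independent uniform picks with repetition. The value
  \<open>0\<close>, which is not a color, is a dummy outside the node set.
\<close>

definition majority3_round :: "nat \<Rightarrow> (nat \<Rightarrow> nat) \<Rightarrow> (nat \<Rightarrow> nat) pmf" where
  "majority3_round n x =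
     Pi_pmf {..<n} 0
       (\<lambda>v. map_pmf (\<lambda>(u1, u2, u3). majority3 (x u1) (x u2) (x u3))
              (pmf_of_set ({..<n} \<times> {..<n} \<times> {..<n})))"

text \<open>The law of the trajectory \<open>[X\<^sub>0, \<dots>, X\<^sub>t]\<close> of the first \<open>t\<close> rounds from \<open>X\<^sub>0 = x\<close>.\<close>

fun majority3_run :: "nat \<Rightarrow> nat \<Rightarrow> (nat \<Rightarrow> nat) \<Rightarrow> (nat \<Rightarrow> nat) list pmf" where
  "majority3_run n 0 x = return_pmf [x]"
| "majority3_run n (Suc t) x =
     bind_pmf (majority3_round n x) (\<lambda>y. map_pmf (Cons x) (majority3_run n t y))"

definition lambda_nk :: "nat \<Rightarrow> nat \<Rightarrow> real" where
  "lambda_nk n k = min (2 * real k) (root 3 (real n / ln (real n)))"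

end

theory Submission
  imports Defs "HOL-Real_Asymp.Real_Asymp"
begin

text \<open>
  A node adopts color \<open>j\<close> with probability \<open>p\<^sub>j (1 + p\<^sub>j - S)\<close>, where \<open>p\<^sub>j\<close> is the fraction of
  nodes of color \<open>j\<close> and \<open>S = (\<Sum>j. p\<^sub>j\<^sup>2)\<close>. While \<open>p\<^sub>1 \<le> 2/3\<close>, a lower bound \<open>s\<close> on all
  differences \<open>c\<^sub>1 - c\<^sub>j\<close> grows in expectation to at least \<open>s (1 + p\<^sub>1 / 3)\<close>. A Bernstein bound and a
  union bound over at most \<open>n\<close> colors give growth to \<open>s (1 + p\<^sub>1 / 6)\<close> in one round except with
  probability \<open>n powr (- 49/72)\<close>; here the hypothesis on the bias enters, together with
  \<open>p\<^sub>1 \<ge> 2 / \<lambda>\<close> for \<open>\<lambda> = lambda_nk n k\<close>. Since \<open>s\<close> cannot exceed \<open>n\<close>, this phase lasts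
  \<open>O(\<lambda> log n)\<close> rounds. Once \<open>p\<^sub>1 \<ge> 2/3\<close>, the expected number of nodes of other colors shrinks by
  the factor \<open>7/9\<close> per round, and Markov's inequality after \<open>O(log n)\<close> rounds yields consensus.
\<close>

section \<open>Concentration\<close>

lemma exp_le_quadratic:
  fixes x :: real
  assumes "\<bar>x\<bar> \<le> 1"
  shows "exp x \<le> 1 + x + x\<^sup>2"
proof (cases "x \<ge> 0")
  case True
  then show ?thesis using assms exp_bound[of x] by simp
next
  case False
  define z where "z = - x"
  have z: "0 \<le> z" "x = - z" using False by (auto simp: z_def)
  \<comment> \<open>The product is \<open>1 + z ^ 3\<close>.\<close>
  have "1 \<le> (1 - z + z\<^sup>2) * (1 + z)"
    using z by (simp add: algebra_simps power2_eq_square)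
  also have "\<dots> \<le> (1 - z + z\<^sup>2) * exp z"
  proof (intro mult_left_mono exp_ge_add_one_self)
    have "1 - z + z\<^sup>2 = (1 - z / 2)\<^sup>2 + 3 / 4 * z\<^sup>2"
      by (simp add: power2_eq_square field_simps)
    then show "0 \<le> 1 - z + z\<^sup>2" by simp
  qed
  finally show ?thesis
    by (simp add: z(2) exp_minus field_simps)
qed

text \<open>Exponential Markov inequality: independence turns the moment generating function into a
  power of one factor, which \<open>exp_le_quadratic\<close> bounds. Keeping the second moment lets
  the variance enter the exponent, and \<open>t\<close> stays free for each application.\<close>

lemma Pi_pmf_bernstein:
  fixes f :: "'b \<Rightarrow> real" and t a :: real
  assumes A: "finite A" and p: "finite (set_pmf p)"
    and f: "\<And>y. \<bar>f y\<bar> \<le> 1" and t: "0 \<le> t" "t \<le> 1"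
  shows "measure_pmf.prob (Pi_pmf A d (\<lambda>_. p)) {y. a \<le> (\<Sum>v\<in>A. f (y v))}
    \<le> exp (- t * a + real (card A) * (t * measure_pmf.expectation p f
        + t\<^sup>2 * measure_pmf.expectation p (\<lambda>y. (f y)\<^sup>2)))"
proof -
  let ?P = "Pi_pmf A d (\<lambda>_. p)"
  let ?m = "measure_pmf.expectation p f"
  let ?q = "measure_pmf.expectation p (\<lambda>y. (f y)\<^sup>2)"
  note int = integrable_measure_pmf_finite[OF p]
  have "finite (set_pmf ?P)"
    unfolding set_Pi_pmf[OF A] using A p by (intro finite_PiE_dflt) auto
  note intP = integrable_measure_pmf_finite[OF this]
  have "measure_pmf.prob ?P {y. a \<le> (\<Sum>v\<in>A. f (y v))}
      = measure_pmf.expectation ?P (indicator {y. a \<le> (\<Sum>v\<in>A. f (y v))})"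
    by simp
  also have "\<dots> \<le> measure_pmf.expectation ?P (\<lambda>y. exp (- t * a) * (\<Prod>v\<in>A. exp (t * f (y v))))"
  proof (intro integral_mono intP)
    fix y
    show "indicator {y. a \<le> (\<Sum>v\<in>A. f (y v))} y \<le> exp (- t * a) * (\<Prod>v\<in>A. exp (t * f (y v)))"
      using t A by (auto simp: indicator_def exp_sum[symmetric] sum_distrib_left[symmetric]
          mult_exp_exp mult_left_mono prod_nonneg)
  qed
  also have "\<dots> = exp (- t * a) * measure_pmf.expectation p (\<lambda>y. exp (t * f y)) ^ card A"
    using A by (simp, subst expectation_prod_Pi_pmf) (auto simp: int)
  also have "\<dots> \<le> exp (- t * a) * exp (t * ?m + t\<^sup>2 * ?q) ^ card A"
  proof (intro mult_left_mono power_mono)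
    have "measure_pmf.expectation p (\<lambda>y. exp (t * f y))
        \<le> measure_pmf.expectation p (\<lambda>y. 1 + t * f y + t\<^sup>2 * (f y)\<^sup>2)"
    proof (intro integral_mono int)
      fix y
      have "\<bar>t * f y\<bar> \<le> 1 * 1"
        unfolding abs_mult using t f[of y] by (intro mult_mono) auto
      then show "exp (t * f y) \<le> 1 + t * f y + t\<^sup>2 * (f y)\<^sup>2"
        using exp_le_quadratic[of "t * f y"] by (simp add: power_mult_distrib)
    qed
    also have "\<dots> = 1 + (t * ?m + t\<^sup>2 * ?q)"
      by (simp add: int)
    also have "\<dots> \<le> exp (t * ?m + t\<^sup>2 * ?q)"
      by (rule exp_ge_add_one_self)
    finally show "measure_pmf.expectation p (\<lambda>y. exp (t * f y)) \<le> exp (t * ?m + t\<^sup>2 * ?q)" .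
  qed (auto intro: integral_nonneg)
  finally show ?thesis
    by (simp add: exp_of_nat_mult[symmetric] mult_exp_exp)
qed

section \<open>The law of one node\<close>

definition frac_color :: "nat \<Rightarrow> (nat \<Rightarrow> nat) \<Rightarrow> nat \<Rightarrow> real" where
  "frac_color n x j = real (config_of n x j) / real n"

text \<open>The sum of squares \<open>S = (\<Sum>j. p\<^sub>j\<^sup>2)\<close>: the probability that
  two random picks agree in color. Averaging over nodes avoids fixing a set of colors.\<close>

definition collision_prob :: "nat \<Rightarrow> (nat \<Rightarrow> nat) \<Rightarrow> real" where
  "collision_prob n x = (\<Sum>u<n. frac_color n x (x u)) / real n"

definition majority3_node :: "nat \<Rightarrow> (nat \<Rightarrow> nat) \<Rightarrow> nat pmf" where
  "majority3_node n x = map_pmf (\<lambda>(u1, u2, u3). majority3 (x u1) (x u2) (x u3))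
     (pmf_of_set ({..<n} \<times> {..<n} \<times> {..<n}))"

lemma majority3_round_eq: "majority3_round n x = Pi_pmf {..<n} 0 (\<lambda>_. majority3_node n x)"
  by (simp add: majority3_round_def majority3_node_def)

lemma config_of_eq_sum: "real (config_of n x j) = (\<Sum>v<n. of_bool (x v = j))"
  by (simp add: config_of_def Int_def)

text \<open>If the second and third picks agree, their color wins; otherwise the first pick decides,
  whether or not it matches one of them. This gives
  \<open>p\<^sub>j\<^sup>2 + p\<^sub>j * (1 - S)\<close>.\<close>

lemma majority3_node_prob:
  assumes "n > 0"
  shows "pmf (majority3_node n x) j
    = frac_color n x j * (1 + frac_color n x j - collision_prob n x)"
proof -
  let ?N = "{..<n}"
  let ?f = "\<lambda>(u1, u2, u3). majority3 (x u1) (x u2) (x u3)"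
  let ?c = "\<lambda>j. real (config_of n x j)"
  have ne: "?N \<times> ?N \<times> ?N \<noteq> {}" using assms by auto
  have c: "(\<Sum>v<n. of_bool (h = x v)) = ?c h" for h
    unfolding config_of_eq_sum by (intro sum.cong) auto
  have "pmf (majority3_node n x) j = real (card {z\<in>?N \<times> ?N \<times> ?N. ?f z = j}) / real n ^ 3"
    unfolding majority3_node_def pmf_map
    by (subst measure_pmf_of_set[OF ne])
       (auto simp: card_cartesian_product power3_eq_cube Int_def vimage_def)
  also have "real (card {z\<in>?N \<times> ?N \<times> ?N. ?f z = j}) = (\<Sum>z\<in>?N \<times> ?N \<times> ?N. of_bool (?f z = j))"
    by (subst sum_of_bool_eq) (auto simp: Int_def)
  also have "\<dots> = (\<Sum>a<n. \<Sum>b<n. \<Sum>c<n. of_bool (majority3 (x a) (x b) (x c) = j))"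
    by (simp add: sum.cartesian_product split_beta' del: sum_of_bool_eq)
  also have "\<dots> = (\<Sum>a<n. \<Sum>b<n. \<Sum>c<n. of_bool (x b = x c) * of_bool (x b = j)
      + of_bool (x a = j) * (1 - of_bool (x b = x c)))"
    by (intro sum.cong refl) (auto simp: majority3_def)
  also have "\<dots> = real n * (\<Sum>b<n. ?c (x b) * of_bool (x b = j))
      + ?c j * (real n * real n - (\<Sum>b<n. ?c (x b)))"
    by (simp add: sum.distrib sum_distrib_left[symmetric] sum_distrib_right[symmetric]
        sum_subtractf c config_of_eq_sum[of n x j] del: sum_of_bool_eq)
  also have "(\<Sum>b<n. ?c (x b) * of_bool (x b = j)) = (\<Sum>b<n. ?c j * of_bool (x b = j))"
    by (intro sum.cong) auto
  also have "\<dots> = ?c j * ?c j"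
    by (simp add: sum_distrib_left[symmetric] config_of_eq_sum[of n x j] del: sum_of_bool_eq)
  also have "(real n * (?c j * ?c j) + ?c j * (real n * real n - (\<Sum>b<n. ?c (x b)))) / real n ^ 3
      = frac_color n x j * (1 + frac_color n x j - collision_prob n x)"
    using assms by (simp add: frac_color_def collision_prob_def sum_divide_distrib[symmetric]
        power3_eq_cube field_simps)
  finally show ?thesis .
qed

text \<open>The average over nodes splits into those of color \<open>j\<close> and the rest, each of
  which contributes at most \<open>b\<close>.\<close>

lemma collision_prob_le:
  assumes n: "n > 0" and b: "\<And>u. u < n \<Longrightarrow> x u \<noteq> j \<Longrightarrow> frac_color n x (x u) \<le> b"
  shows "collision_prob n x \<le> (frac_color n x j)\<^sup>2 + (1 - frac_color n x j) * b"
proof -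
  let ?p = "frac_color n x j"
  have p: "real (card ({..<n} \<inter> {u. x u = j})) = ?p * real n"
    using n by (simp add: frac_color_def config_of_def Int_def)
  have "(\<Sum>u<n. frac_color n x (x u)) \<le> (\<Sum>u<n. of_bool (x u = j) * ?p + (1 - of_bool (x u = j)) * b)"
    by (intro sum_mono) (auto simp: b)
  also have "\<dots> = real n * (?p\<^sup>2 + (1 - ?p) * b)"
    by (simp add: sum.distrib sum_distrib_right[symmetric] sum_subtractf p
        power2_eq_square algebra_simps)
  finally show ?thesis
    using n by (simp add: collision_prob_def field_simps)
qed

lemma frac_color_nonneg [simp]: "0 \<le> frac_color n x j"
  by (simp add: frac_color_def)

lemma collision_prob_nonneg [simp]: "0 \<le> collision_prob n x"
  by (simp add: collision_prob_def sum_nonneg)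

lemma frac_color_add_le_1:
  assumes "n > 0" "i \<noteq> j"
  shows "frac_color n x i + frac_color n x j \<le> 1"
proof -
  have "real (config_of n x i) + real (config_of n x j) \<le> (\<Sum>v<n. 1)"
    unfolding config_of_eq_sum sum.distrib[symmetric] using assms(2) by (intro sum_mono) auto
  then show ?thesis using assms by (simp add: frac_color_def field_simps)
qed

lemma frac_color_le_1: "n > 0 \<Longrightarrow> frac_color n x j \<le> 1"
  using frac_color_add_le_1[of n j "Suc j" x] frac_color_nonneg[of n x "Suc j"] by linarith

lemma collision_prob_le_1: 
  assumes "n > 0"
  shows "collision_prob n x \<le> 1"
  using sum_bounded_above[of "{..<n}" "\<lambda>u. frac_color n x (x u)" 1] frac_color_le_1[OF assms] assms
  by (simp add: collision_prob_def)

section \<open>The probability of missing consensus\<close>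

text \<open>The complementary event is used because the errors of successive rounds then simply add
  up.\<close>

definition fail_prob :: "nat \<Rightarrow> nat \<Rightarrow> (nat \<Rightarrow> nat) \<Rightarrow> real" where
  "fail_prob n t x = measure_pmf.prob (majority3_run n t x) {ys. \<not> (\<exists>y\<in>set ys. \<forall>v<n. y v = 1)}"

lemma finite_set_majority3_node [simp]: "n > 0 \<Longrightarrow> finite (set_pmf (majority3_node n x))"
  by (auto simp: majority3_node_def set_map_pmf set_pmf_of_set lessThan_empty_iff)

lemma finite_set_majority3_round [simp]: "n > 0 \<Longrightarrow> finite (set_pmf (majority3_round n x))"
  unfolding majority3_round_eq set_Pi_pmf[OF finite_lessThan] by (intro finite_PiE_dflt) auto

lemma majority3_cases: "majority3 a b c \<in> {a, b, c}"
  by (simp add: majority3_def)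

text \<open>Nodes only copy colors they see, so extinct colors never return. This lets the union
  bound run over the colors present.\<close>

lemma set_majority3_round:
  assumes "n > 0" "y \<in> set_pmf (majority3_round n x)" "v < n"
  shows "y v \<in> x ` {..<n}"
proof -
  have "y v \<in> set_pmf (majority3_node n x)"
    using assms unfolding majority3_round_eq set_Pi_pmf[OF finite_lessThan]
    by (auto simp: PiE_dflt_def)
  also have "\<dots> \<subseteq> x ` {..<n}"
    using assms(1) majority3_cases
    by (fastforce simp: majority3_node_def set_map_pmf set_pmf_of_set lessThan_empty_iff)
  finally show ?thesis .
qed

lemma fail_prob_0: "fail_prob n 0 x = of_bool (\<not> (\<forall>v<n. x v = 1))"
  by (auto simp: fail_prob_def indicator_def)

lemma fail_prob_le_1 [simp]: "fail_prob n t x \<le> 1"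
  by (simp add: fail_prob_def)

lemma fail_prob_consensus:
  assumes "\<forall>v<n. x v = 1"
  shows "fail_prob n t x = 0"
proof -
  have "x \<in> set ys" if "ys \<in> set_pmf (majority3_run n t x)" for ys
    using that by (cases t) (auto simp: set_map_pmf set_bind_pmf)
  then show ?thesis
    unfolding fail_prob_def using assms
    by (subst measure_pmf.prob_eq_0) (auto simp: AE_measure_pmf_iff)
qed

text \<open>Conditioning on the first round; dropping the starting state from the trajectory can
  only enlarge the failure event.\<close>

lemma fail_prob_Suc:
  assumes "n > 0"
  shows "fail_prob n (Suc t) x \<le> measure_pmf.expectation (majority3_round n x) (fail_prob n t)"
proof -
  let ?A = "{ys. \<not> (\<exists>y\<in>set ys. \<forall>v<n. y v = 1)}"
  have "fail_prob n (Suc t) x = measure_pmf.expectation (majority3_run n (Suc t) x) (indicator ?A)"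
    by (simp add: fail_prob_def)
  also have "\<dots> = measure_pmf.expectation (majority3_round n x)
      (\<lambda>y. measure_pmf.prob (map_pmf (Cons x) (majority3_run n t y)) ?A)"
  proof -
    have "ennreal (measure_pmf.prob (majority3_run n (Suc t) x) ?A)
      = ennreal (measure_pmf.expectation (majority3_round n x)
      (\<lambda>y. measure_pmf.prob (map_pmf (Cons x) (majority3_run n t y)) ?A))"
      unfolding measure_pmf.emeasure_eq_measure[symmetric] majority3_run.simps emeasure_bind_pmf
      unfolding measure_pmf.emeasure_eq_measure
      by (intro nn_integral_eq_integral integrable_measure_pmf_finite) (use assms in auto)
    then show ?thesis by (simp add: Bochner_Integration.integral_nonneg del: majority3_run.simps)
  qed
  also have "\<dots> \<le> measure_pmf.expectation (majority3_round n x) (fail_prob n t)"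
    using assms
    by (intro integral_mono integrable_measure_pmf_finite)
       (auto simp: fail_prob_def intro!: measure_pmf.finite_measure_mono)
  finally show ?thesis .
qed

text \<open>The induction step of both phases: a bad round costs \<open>e\<close>, otherwise
  \<open>g\<close> takes over. Since \<open>g\<close> is nonnegative, \<open>1 + g\<close> dominates
  the failure probability on \<open>B\<close> as well.\<close>

lemma fail_prob_Suc_le:
  assumes n: "n > 0"
    and bad: "measure_pmf.prob (majority3_round n x) B \<le> e"
    and good: "\<And>y. y \<in> set_pmf (majority3_round n x) \<Longrightarrow> y \<notin> B \<Longrightarrow> fail_prob n t y \<le> g y"
    and g: "\<And>y. y \<in> set_pmf (majority3_round n x) \<Longrightarrow> 0 \<le> g y"
  shows "fail_prob n (Suc t) x \<le> e + measure_pmf.expectation (majority3_round n x) g"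
proof -
  note int = integrable_measure_pmf_finite[OF finite_set_majority3_round[OF n, of x]]
  have "fail_prob n (Suc t) x \<le> measure_pmf.expectation (majority3_round n x) (fail_prob n t)"
    by (rule fail_prob_Suc[OF n])
  also have "\<dots> \<le> measure_pmf.expectation (majority3_round n x) (\<lambda>y. indicator B y + g y)"
  proof (intro integral_mono_AE int)
    show "AE y in majority3_round n x. fail_prob n t y \<le> indicator B y + g y"
      using good g by (auto simp: AE_measure_pmf_iff indicator_def intro: add_increasing2)
  qed
  also have "\<dots> \<le> e + measure_pmf.expectation (majority3_round n x) g"
    using bad by (simp add: int)
  finally show ?thesis .
qed

lemma majority3_round_tail:
  fixes f :: "nat \<Rightarrow> real" and t a :: real
  assumes "n > 0" "\<And>y. \<bar>f y\<bar> \<le> 1" "0 \<le> t" "t \<le> 1"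
  shows "measure_pmf.prob (majority3_round n x) {y. a \<le> (\<Sum>v<n. f (y v))}
    \<le> exp (- t * a + real n * (t * measure_pmf.expectation (majority3_node n x) f
        + t\<^sup>2 * measure_pmf.expectation (majority3_node n x) (\<lambda>y. (f y)\<^sup>2)))"
  using Pi_pmf_bernstein[of "{..<n}" "majority3_node n x" f t 0 a] assms
  by (simp add: majority3_round_eq)

lemma expectation_of_bool_eq: "measure_pmf.expectation p (\<lambda>y. of_bool (y = j)) = pmf p j"
proof -
  have "(\<lambda>y. of_bool (y = j)) = (indicator {j} :: _ \<Rightarrow> real)"
    by (auto simp: indicator_def)
  then show ?thesis by (simp add: pmf.rep_eq)
qed

section \<open>One-round estimates\<close>

text \<open>The tail bound is applied to the difference of the indicators of \<open>j\<close> and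
  \<open>1\<close>. Its second moment is at most \<open>4 * p1\<close>, so the exponent keeps a
  factor \<open>p1\<close> although the drift exceeds the target by only
  \<open>s * p1 / 6\<close>.\<close>

lemma prob_bias_step:
  fixes s :: real
  assumes n: "n > 0" and j: "j \<noteq> 1" and s: "0 \<le> s"
    and le: "\<And>i. i \<noteq> 1 \<Longrightarrow> real (config_of n x i) + s \<le> real (config_of n x 1)"
    and p: "frac_color n x 1 \<le> 2 / 3"
  shows "measure_pmf.prob (majority3_round n x)
      {y. real (config_of n y 1) - real (config_of n y j) \<le> s * (1 + frac_color n x 1 / 6)}
    \<le> exp (- (s\<^sup>2 * frac_color n x 1 / (576 * real n)))"
proof -
  define p1 pj S \<sigma> where "p1 = frac_color n x 1" and "pj = frac_color n x j"
    and "S = collision_prob n x" and "\<sigma> = s / real n"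
  have s_eq: "s = \<sigma> * real n" using n by (simp add: \<sigma>_def)
  have \<sigma>0: "0 \<le> \<sigma>" using s by (simp add: \<sigma>_def)
  have frac: "frac_color n x i \<le> p1 - \<sigma>" if "i \<noteq> 1" for i
    using le[OF that] n by (simp add: p1_def \<sigma>_def frac_color_def field_simps)
  have pj: "0 \<le> pj" "pj \<le> p1 - \<sigma>" using frac[OF j] by (auto simp: pj_def)
  have p1: "0 \<le> p1" "p1 \<le> 2/3" using p by (auto simp: p1_def)
  have S0: "0 \<le> S" "S \<le> 1" using collision_prob_le_1[OF n] by (auto simp: S_def)
  have S: "S \<le> p1\<^sup>2 + (1 - p1) * (p1 - \<sigma>)"
    unfolding S_def p1_def using frac n by (intro collision_prob_le) (auto simp: p1_def)
  define f where "f = (\<lambda>y::nat. of_bool (y = j) - of_bool (y = 1) :: real)"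
  note int = integrable_measure_pmf_finite[OF finite_set_majority3_node[OF n, of x]]
  let ?q = "pmf (majority3_node n x)"
  have q: "?q 1 = p1 * (1 + p1 - S)" "?q j = pj * (1 + pj - S)"
    using majority3_node_prob[OF n] by (auto simp: p1_def pj_def S_def)
  have Ef: "measure_pmf.expectation (majority3_node n x) f = ?q j - ?q 1"
    by (simp add: f_def int expectation_of_bool_eq)
  have "(\<lambda>y. (f y)\<^sup>2) = (\<lambda>y. of_bool (y = j) + of_bool (y = 1))"
    using j by (auto simp: f_def fun_eq_iff)
  then have Ef2: "measure_pmf.expectation (majority3_node n x) (\<lambda>y. (f y)\<^sup>2) = ?q j + ?q 1"
    by (simp add: int expectation_of_bool_eq)
  \<comment> \<open>The drift is decreasing in \<open>pj\<close>, so its worst value is at \<open>pj = p1 - \<sigma>\<close>.\<close>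
  have "(p1 - pj) * (1 - S) \<ge> \<sigma> * (1 - S)"
    using pj S0 by (intro mult_right_mono) auto
  moreover have "pj * pj \<le> (p1 - \<sigma>) * (p1 - \<sigma>)"
    using pj by (intro mult_mono) auto
  ultimately have "?q 1 - ?q j \<ge> \<sigma> * (1 - S) + p1\<^sup>2 - (p1 - \<sigma>)\<^sup>2"
    unfolding q by (simp add: power2_eq_square algebra_simps)
  also have "\<sigma> * (1 - S) + p1\<^sup>2 - (p1 - \<sigma>)\<^sup>2 = \<sigma> * (1 + p1 + (p1 - \<sigma>) - S)"
    by (simp add: power2_eq_square algebra_simps)
  finally have drift: "?q 1 - ?q j \<ge> \<sigma> * (1 + p1 + (p1 - \<sigma>) - S)" .
  \<comment> \<open>Inserting the bound on \<open>S\<close> leaves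
    \<open>1 + p1 - p1 * \<sigma>\<close>, and
    \<open>p1 * \<sigma> \<le> p1 * p1 \<le> 2 / 3 * p1\<close>.\<close>
  have "p1 * (p1 - \<sigma>) \<ge> 0" "p1 * p1 \<le> p1 * (2/3)"
    using p1 pj \<sigma>0 mult_left_mono[of p1 "2 / 3" p1] by auto
  then have "1 + p1 / 3 \<le> 1 + p1 + (p1 - \<sigma>) - S"
    using S by (simp add: power2_eq_square algebra_simps)
  then have "\<sigma> * (1 + p1 / 3) \<le> \<sigma> * (1 + p1 + (p1 - \<sigma>) - S)"
    using \<sigma>0 by (rule mult_left_mono)
  with drift have drift: "?q 1 - ?q j \<ge> \<sigma> * (1 + p1 / 3)" by linarith
  have "?q 1 \<le> p1 * 2" "?q j \<le> p1 * 2"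
    unfolding q using pj p1 S0 \<sigma>0 by (auto intro!: mult_mono)
  then have var: "?q j + ?q 1 \<le> 4 * p1" by linarith
  have \<sigma>1: "\<sigma> \<le> 1" using pj p1 by linarith
  \<comment> \<open>This value maximizes \<open>t * \<sigma> * p1 / 6 - 4 * t\<^sup>2 * p1\<close>,
    the gain per node in the exponent.\<close>
  define t where "t = \<sigma> / 48"
  have t: "0 \<le> t" "t \<le> 1" using \<sigma>0 \<sigma>1 by (auto simp: t_def)
  define a where "a = - (s * (1 + p1 / 6))"
  have "measure_pmf.prob (majority3_round n x)
      {y. real (config_of n y 1) - real (config_of n y j) \<le> s * (1 + p1 / 6)}
    = measure_pmf.prob (majority3_round n x) {y. a \<le> (\<Sum>v<n. f (y v))}"
    by (simp add: f_def sum_subtractf config_of_eq_sum a_def algebra_simps del: sum_of_bool_eq)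
  also have "\<dots> \<le> exp (- t * a + real n * (t * (?q j - ?q 1) + t\<^sup>2 * (?q j + ?q 1)))"
    unfolding Ef[symmetric] Ef2[symmetric]
    by (intro majority3_round_tail n t) (auto simp: f_def)
  also have "\<dots> \<le> exp (- (s\<^sup>2 * p1 / (576 * real n)))"
  proof -
    have "t * (?q j - ?q 1) + t\<^sup>2 * (?q j + ?q 1) \<le> t * (- (\<sigma> * (1 + p1 / 3))) + t\<^sup>2 * (4 * p1)"
      using t drift var by (intro add_mono mult_left_mono) auto
    then have "real n * (t * (?q j - ?q 1) + t\<^sup>2 * (?q j + ?q 1))
      \<le> real n * (t * (- (\<sigma> * (1 + p1 / 3))) + t\<^sup>2 * (4 * p1))"
      by (rule mult_left_mono) simp
    moreover have "- t * a + real n * (t * (- (\<sigma> * (1 + p1 / 3))) + t\<^sup>2 * (4 * p1))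
      = - (s\<^sup>2 * p1 / (576 * real n))"
      using n by (simp add: a_def t_def s_eq power2_eq_square field_simps)
    ultimately show ?thesis by simp
  qed
  finally show ?thesis by (simp add: p1_def)
qed

section \<open>Contraction of the minority once color 1 holds two thirds of the nodes\<close>

lemma minority_drift:
  fixes d :: real
  assumes "0 \<le> d" "d \<le> 1 / 3"
  shows "d * (3 * d - 2 * d\<^sup>2) \<le> 7 / 9 * d"
proof -
  \<comment> \<open>The product is \<open>7 / 9 - 3 * d + 2 * d\<^sup>2\<close>; the rate 7/9 is the
    value of \<open>3 * d - 2 * d\<^sup>2\<close> at \<open>d = 1 / 3\<close>.\<close>
  have "0 \<le> (1 / 3 - d) * (7 / 3 - 2 * d)" using assms by simp
  then have "3 * d - 2 * d\<^sup>2 \<le> 7 / 9" by (simp add: power2_eq_square field_simps)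
  from mult_left_mono[OF this assms(1)] show ?thesis by simp
qed

text \<open>The collision probability is largest when all other nodes share one color, which gives
  \<open>S \<le> (1 - d)\<^sup>2 + d\<^sup>2\<close> for the minority fraction
  \<open>d\<close>.\<close>

lemma node_minority_prob:
  assumes n: "n > 0" and D: "1 - frac_color n x 1 \<le> 1 / 3"
  shows "1 - pmf (majority3_node n x) 1 \<le> 7 / 9 * (1 - frac_color n x 1)"
proof -
  define d where "d = 1 - frac_color n x 1"
  have d: "0 \<le> d" "d \<le> 1 / 3" using D frac_color_le_1[OF n] by (auto simp: d_def)
  have p: "frac_color n x 1 = 1 - d" by (simp add: d_def)
  have "collision_prob n x \<le> (1 - d)\<^sup>2 + d * d"
    using collision_prob_le[OF n, of x 1 d] frac_color_add_le_1[OF n, of _ 1 x]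
    by (force simp: p d_def algebra_simps)
  then have "(1 - d) * (1 + (1 - d) - ((1 - d)\<^sup>2 + d * d)) \<le> (1 - d) * (1 + (1 - d) - collision_prob n x)"
    using d by (intro mult_left_mono) auto
  then have "1 - pmf (majority3_node n x) 1 \<le> d * (3 * d - 2 * d\<^sup>2)"
    unfolding majority3_node_prob[OF n] p by (simp add: power2_eq_square algebra_simps)
  with minority_drift[OF d] show ?thesis unfolding d_def[symmetric] by linarith
qed

lemma minority_eq_sum: "real n - real (config_of n y 1) = (\<Sum>v<n. 1 - of_bool (y v = 1))"
  by (simp add: sum_subtractf config_of_eq_sum del: sum_of_bool_eq)

lemma expectation_minority:
  assumes n: "n > 0"
  shows "measure_pmf.expectation (majority3_round n x) (\<lambda>y. real n - real (config_of n y 1))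
    = real n * (1 - pmf (majority3_node n x) 1)"
proof -
  note int = integrable_measure_pmf_finite[OF finite_set_majority3_round[OF n, of x]]
  have "measure_pmf.expectation (majority3_round n x) (\<lambda>y. of_bool (y v = 1))
      = pmf (majority3_node n x) 1" if "v < n" for v
  proof -
    have "map_pmf (\<lambda>y. y v) (majority3_round n x) = majority3_node n x"
      using that unfolding majority3_round_eq by (subst Pi_pmf_component) auto
    then have "pmf (majority3_node n x) 1
      = measure_pmf.expectation (map_pmf (\<lambda>y. y v) (majority3_round n x)) (\<lambda>c. of_bool (c = 1))"
      unfolding expectation_of_bool_eq by simp
    then show ?thesis by simp
  qed
  then show ?thesis
    unfolding minority_eq_sum by (simp add: int)
qed

text \<open>The expected minority is at most \<open>7 / 27 * n\<close>, a linear distance below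
  \<open>n / 3\<close>, so leaving the two-thirds region is exponentially unlikely.\<close>

lemma prob_minority_large:
  assumes n: "n > 0" and D: "real n - real (config_of n x 1) \<le> real n / 3"
  shows "measure_pmf.prob (majority3_round n x) {y. real n / 3 \<le> real n - real (config_of n y 1)}
    \<le> exp (- (real n / 189))"
proof -
  define f where "f = (\<lambda>y::nat. 1 - of_bool (y = 1) :: real)"
  note int = integrable_measure_pmf_finite[OF finite_set_majority3_node[OF n, of x]]
  have d: "1 - frac_color n x 1 \<le> 1 / 3"
    using D n by (simp add: frac_color_def field_simps)
  have f1: "\<bar>f y\<bar> \<le> 1" for y by (simp add: f_def)
  have Ef: "measure_pmf.expectation (majority3_node n x) f = 1 - pmf (majority3_node n x) 1"
    by (simp add: f_def int expectation_of_bool_eq)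
  have f2: "(\<lambda>y. (f y)\<^sup>2) = f" by (auto simp: f_def fun_eq_iff)
  have q: "1 - pmf (majority3_node n x) 1 \<le> 7 / 27"
    using node_minority_prob[OF n d] d by simp
  have "measure_pmf.prob (majority3_round n x) {y. real n / 3 \<le> real n - real (config_of n y 1)}
    = measure_pmf.prob (majority3_round n x) {y. real n / 3 \<le> (\<Sum>v<n. f (y v))}"
    unfolding minority_eq_sum f_def ..
  \<comment> \<open>An indicator equals its square, so the exponent per node is at most
    \<open>7 / 27 * t\<^sup>2 - 2 / 27 * t\<close>, minimal at \<open>t = 1 / 7\<close>.\<close>
  also have "\<dots> \<le> exp (- (1 / 7) * (real n / 3)
      + real n * ((1 / 7) * (1 - pmf (majority3_node n x) 1) + (1 / 7)\<^sup>2 * (1 - pmf (majority3_node n x) 1)))"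
    using majority3_round_tail[of n f "1 / 7" x "real n / 3"] n f1 by (simp add: Ef f2)
  also have "\<dots> \<le> exp (- (real n / 189))"
  proof -
    have "real n * ((1 / 7) * (1 - pmf (majority3_node n x) 1) + (1 / 7)\<^sup>2 * (1 - pmf (majority3_node n x) 1))
       \<le> real n * ((1 / 7) * (7 / 27) + (1 / 7)\<^sup>2 * (7 / 27))"
      using q by (intro mult_left_mono add_mono) auto
    then show ?thesis by (simp add: field_simps)
  qed
  finally show ?thesis .
qed

lemma consensus_iff: "(\<forall>v<n. x v = 1) \<longleftrightarrow> config_of n x 1 = n"
proof
  assume "config_of n x 1 = n"
  then have "{v \<in> {..<n}. x v = 1} = {..<n}"
    by (intro card_subset_eq) (auto simp: config_of_def)
  then show "\<forall>v<n. x v = 1" by auto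
next
  assume "\<forall>v<n. x v = 1"
  then have "{v \<in> {..<n}. x v = 1} = {..<n}" by auto
  then show "config_of n x 1 = n" by (simp add: config_of_def)
qed

lemma config_of_le: "config_of n x j \<le> n"
  unfolding config_of_def using card_mono[of "{..<n}" "{v \<in> {..<n}. x v = j}"] by auto

text \<open>The contraction holds only inside the region, so every round also pays for the chance of
  leaving it. The bound is affine in the minority count, hence expectations pass through the
  induction.\<close>

lemma fail_prob_large_majority:
  assumes n: "n > 0" and D: "real n - real (config_of n x 1) \<le> real n / 3"
  shows "fail_prob n t x \<le> (7 / 9) ^ t * (real n - real (config_of n x 1)) + real t * exp (- (real n / 189))"
  using D
proof (induction t arbitrary: x)
  case 0
  \<comment> \<open>Markov's inequality in its simplest form: without consensus the minority count
    is an integer, hence at least 1.\<close>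
  then show ?case
    using config_of_le[of n x 1] by (cases "config_of n x 1 = n") (simp_all add: fail_prob_0 consensus_iff del: One_nat_def)
next
  case (Suc t)
  let ?D = "\<lambda>y. real n - real (config_of n y 1)"
  let ?e = "exp (- (real n / 189))"
  note int = integrable_measure_pmf_finite[OF finite_set_majority3_round[OF n, of x]]
  have "fail_prob n (Suc t) x \<le> ?e + measure_pmf.expectation (majority3_round n x)
     (\<lambda>y. (7 / 9) ^ t * ?D y + real t * ?e)"
  proof (rule fail_prob_Suc_le[OF n prob_minority_large[OF n Suc.prems]])
    fix y assume "y \<notin> {y. real n / 3 \<le> ?D y}"
    then show "fail_prob n t y \<le> (7 / 9) ^ t * ?D y + real t * ?e" by (intro Suc.IH) simp
  qed (auto intro!: add_nonneg_nonneg mult_nonneg_nonneg simp: config_of_le)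
  also have "\<dots> = ?e + ((7 / 9) ^ t * (real n * (1 - pmf (majority3_node n x) 1)) + real t * ?e)"
    unfolding expectation_minority[OF n, symmetric] by (simp add: int)
  also have "\<dots> \<le> ?e + ((7 / 9) ^ t * (7 / 9 * ?D x) + real t * ?e)"
  proof -
    have "1 - frac_color n x 1 \<le> 1 / 3" using Suc.prems n by (simp add: frac_color_def field_simps)
    from node_minority_prob[OF n this] n
    have "real n * (1 - pmf (majority3_node n x) 1) \<le> 7 / 9 * ?D x"
      by (simp add: frac_color_def field_simps)
    then show ?thesis by (intro add_mono mult_left_mono) auto
  qed
  finally show ?case by (simp add: algebra_simps)
qed

section \<open>Growth of the bias\<close>

text \<open>The order among the other colors is not preserved, so color 1 is compared with each of
  them, against a bound \<open>s\<close> that may be raised every round. The second clause also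
  gives color 1 at least \<open>s\<close> nodes.\<close>

definition biased :: "nat \<Rightarrow> nat \<Rightarrow> real \<Rightarrow> (nat \<Rightarrow> nat) \<Rightarrow> bool" where
  "biased n k s x \<longleftrightarrow> (\<forall>v<n. x v \<in> {1..k}) \<and>
     (\<forall>i. i \<noteq> 1 \<longrightarrow> real (config_of n x i) + s \<le> real (config_of n x 1))"

text \<open>Pigeonhole: color 1 is a largest of at most \<open>k\<close> classes covering all
  nodes.\<close>

lemma frac_color_ge_of_colors:
  assumes n: "n > 0" and b: "biased n k s x" and s: "0 \<le> s"
  shows "1 \<le> real k * frac_color n x 1"
proof -
  have "(\<Union>i\<in>{1..k}. {v\<in>{..<n}. x v = i}) = {..<n}"
    using b by (auto simp: biased_def)
  then have "n \<le> (\<Sum>i\<in>{1..k}. config_of n x i)"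
    unfolding config_of_def
    using card_UN_le[of "{1..k}" "\<lambda>i. {v\<in>{..<n}. x v = i}"] by (metis card_lessThan finite_atLeastAtMost)
  also have "\<dots> \<le> (\<Sum>i\<in>{1..k}. config_of n x 1)"
  proof (intro sum_mono)
    fix i
    show "config_of n x i \<le> config_of n x 1"
    proof (cases "i = 1")
      case False
      then have "real (config_of n x i) + s \<le> real (config_of n x 1)" using b by (simp add: biased_def)
      then show ?thesis using s by linarith
    qed simp
  qed
  finally have "real n \<le> real (k * config_of n x 1)" by (subst of_nat_le_iff) simp
  then show ?thesis using n by (simp add: frac_color_def field_simps)
qed

text \<open>If the minimum is \<open>2 * k\<close>, this is the pigeonhole bound. If it is the cube
  root \<open>L\<close>, then \<open>L * n * ln n = (n / L)\<^sup>2\<close>, so the bias alone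
  forces at least \<open>22 * n / L\<close> nodes of color 1.\<close>

lemma frac_color_ge_lambda:
  assumes n: "n > 0" "ln (real n) > 0" and b: "biased n k s x"
    and s: "22 * sqrt (lambda_nk n k * real n * ln (real n)) \<le> s" and L: "lambda_nk n k > 0"
  shows "2 \<le> lambda_nk n k * frac_color n x 1"
proof -
  define L where "L = lambda_nk n k"
  have s0: "0 \<le> s" using s L n by (smt (verit) mult_nonneg_nonneg real_sqrt_ge_zero of_nat_0_le_iff)
  show ?thesis
  proof (cases "L = 2 * real k")
    case True
    then show ?thesis using frac_color_ge_of_colors[OF n(1) b s0] by (simp add: L_def)
  next
    case False
    then have "L = root 3 (real n / ln (real n))" by (simp add: L_def lambda_nk_def min_def split: if_splits)
    then have "L ^ 3 = real n / ln (real n)" using n by simp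
    then have ln: "ln (real n) = real n / L ^ 3" using n L by (simp add: field_simps L_def)
    have "lambda_nk n k * real n * ln (real n) = (real n / L)\<^sup>2"
      unfolding ln using L by (simp add: L_def power2_eq_square power3_eq_cube)
    then have "22 * (real n / L) \<le> s"
      using s n L by (simp add: L_def)
    also have "s \<le> real (config_of n x 1)"
      using b unfolding biased_def by (smt (verit) of_nat_0_le_iff zero_neq_one)
    finally have "22 \<le> L * frac_color n x 1"
      using n L by (simp add: L_def frac_color_def field_simps)
    then show ?thesis by (simp add: L_def)
  qed
qed

text \<open>A union bound over the at most \<open>n\<close> colors present before the round, other
  than color 1.\<close>

lemma prob_not_biased_step:
  fixes s :: real
  assumes n: "n > 0" and b: "biased n k s x" and s: "0 \<le> s" and p: "frac_color n x 1 \<le> 2 / 3"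
  shows "measure_pmf.prob (majority3_round n x) {y. \<not> biased n k (s * (1 + frac_color n x 1 / 6)) y}
    \<le> real n * exp (- (s\<^sup>2 * frac_color n x 1 / (576 * real n)))"
proof -
  let ?s = "s * (1 + frac_color n x 1 / 6)"
  let ?J = "x ` {..<n} - {1}"
  let ?B = "\<lambda>j. {y. real (config_of n y 1) - real (config_of n y j) \<le> ?s}"
  have bad: "\<exists>j\<in>?J. y \<in> ?B j" if y: "y \<in> set_pmf (majority3_round n x)" and nb: "\<not> biased n k ?s y" for y
  proof -
    note yx = set_majority3_round[OF n y]
    have "\<forall>v<n. y v \<in> {1..k}" using yx b unfolding biased_def by fastforce
    with nb obtain i where i: "i \<noteq> 1" "real (config_of n y 1) < real (config_of n y i) + ?s"
      unfolding biased_def by (auto simp: not_le)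
    show ?thesis
    proof (cases "i \<in> x ` {..<n}")
      case True
      with i show ?thesis by (intro bexI[of _ i]) auto
    next
      case False
      then have none: "{v\<in>{..<n}. y v = i} = {}" using yx by auto
      \<comment> \<open>An extinct color violates the bound only if color 1 itself has fewer than
        \<open>?s\<close> nodes. Then every other color violates it too, and some other color is
        present because \<open>p1 \<le> 2 / 3\<close>.\<close>
      have "config_of n x 1 \<noteq> n" using p n by (auto simp: frac_color_def)
      then obtain v where "v < n" "x v \<noteq> 1" unfolding consensus_iff[symmetric] by auto
      moreover have "config_of n y i = 0" unfolding config_of_def none by simp
      ultimately show ?thesis using i by (intro bexI[of _ "x v"]) auto
    qed
  qed
  have "measure_pmf.prob (majority3_round n x) {y. \<not> biased n k ?s y}
    \<le> measure_pmf.prob (majority3_round n x) (\<Union>j\<in>?J. ?B j)"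
    using bad by (intro measure_pmf.finite_measure_mono_AE) (auto simp: AE_measure_pmf_iff)
  also have "\<dots> \<le> (\<Sum>j\<in>?J. measure_pmf.prob (majority3_round n x) (?B j))"
    by (intro measure_pmf.finite_measure_subadditive_finite) auto
  also have "\<dots> \<le> (\<Sum>j\<in>?J. exp (- (s\<^sup>2 * frac_color n x 1 / (576 * real n))))"
    using b unfolding biased_def by (intro sum_mono prob_bias_step[OF n _ s _ p]) auto
  also have "\<dots> = real (card ?J) * exp (- (s\<^sup>2 * frac_color n x 1 / (576 * real n)))"
    by simp
  also have "\<dots> \<le> real n * exp (- (s\<^sup>2 * frac_color n x 1 / (576 * real n)))"
  proof (intro mult_right_mono)
    have "card ?J \<le> card (x ` {..<n})" by (intro card_mono) auto
    also have "\<dots> \<le> n" using card_image_le[of "{..<n}" x] by simp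
    finally show "real (card ?J) \<le> real n" by simp
  qed simp
  finally show ?thesis .
qed

text \<open>Induction on the growth rounds \<open>m\<close> still sufficient to lift
  \<open>s\<close> to \<open>n\<close> at the guaranteed rate \<open>1 + 1 / (3 * L)\<close>, where
  \<open>L\<close> is \<open>lambda_nk n k\<close>; this rate is implied by
  \<open>p1 \<ge> 2 / L\<close>. At \<open>m = 0\<close> the bias is \<open>n\<close>, which is
  consensus.\<close>

lemma fail_prob_biased:
  fixes s :: real
  defines "e \<equiv> \<lambda>n. real n * real n powr (- (121 / 72))"
  assumes n: "n > 0" "ln (real n) > 0" and L: "lambda_nk n k > 0"
    and b: "biased n k s x"
    and s: "22 * sqrt (lambda_nk n k * real n * ln (real n)) \<le> s"
    and m: "real n \<le> s * (1 + 1 / (3 * lambda_nk n k)) ^ m"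
  shows "fail_prob n (m + t) x
    \<le> real m * e n + ((7 / 9) ^ t * real n + real (m + t) * exp (- (real n / 189)))"
  using b s m
proof (induction m arbitrary: s x)
  case (0 s x)
  have "s \<le> real (config_of n x 1)"
    using 0(1) unfolding biased_def by (smt (verit) of_nat_0_le_iff zero_neq_one)
  with 0(3) have D: "real (config_of n x 1) = real n" using config_of_le[of n x 1] by simp
  have "fail_prob n t x \<le> (7 / 9) ^ t * (real n - real (config_of n x 1)) + real t * exp (- (real n / 189))"
    by (intro fail_prob_large_majority n) (simp add: D del: One_nat_def)
  then show ?case unfolding D by (simp add: add_increasing del: One_nat_def)
next
  case (Suc m s x)
  let ?L = "lambda_nk n k" and ?p = "frac_color n x 1" and ?r = "exp (- (real n / 189))"
  have s0: "0 \<le> s" using Suc.prems(2) L n by (smt (verit) mult_nonneg_nonneg real_sqrt_ge_zero of_nat_0_le_iff)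
  have e0: "0 \<le> e n" by (simp add: e_def)
  show ?case
  proof (cases "?p \<le> 2 / 3")
    case False
    \<comment> \<open>Growth may end early; all remaining rounds then go to the contraction
      phase.\<close>
    then have "real n - real (config_of n x 1) \<le> real n / 3"
      using n by (simp add: frac_color_def field_simps)
    then have "fail_prob n (Suc m + t) x
      \<le> (7 / 9) ^ (Suc m + t) * (real n - real (config_of n x 1)) + real (Suc m + t) * ?r"
      by (rule fail_prob_large_majority[OF n(1)])
    also have "\<dots> \<le> (7 / 9) ^ t * real n + real (Suc m + t) * ?r"
      using config_of_le[of n x 1] by (intro add_mono mult_mono power_decreasing) auto
    finally show ?thesis using e0 by (simp add: add_increasing del: of_nat_Suc)
  next
    case True
    have Lp: "2 \<le> ?L * ?p" by (rule frac_color_ge_lambda[OF n Suc.prems(1,2) L])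
    have step: "s * (1 + 1 / (3 * ?L)) \<le> s * (1 + ?p / 6)"
      using Lp L s0 by (intro mult_left_mono) (auto simp: field_simps)
    \<comment> \<open>Squaring the bias bound gives 484, \<open>?L * ?p \<ge> 2\<close> removes
      \<open>?L\<close> and doubles this to 968, and 968/576 = 121/72.\<close>
    have "real n * exp (- (s\<^sup>2 * ?p / (576 * real n))) \<le> e n"
    proof -
      have "(22 * sqrt (?L * real n * ln (real n)))\<^sup>2 \<le> s\<^sup>2"
        using Suc.prems(2) L n by (intro power_mono) auto
      then have "484 * (?L * real n * ln (real n)) \<le> s\<^sup>2"
        using L n by (simp add: power_mult_distrib)
      then have "484 * (?L * real n * ln (real n)) * ?p \<le> s\<^sup>2 * ?p"
        by (rule mult_right_mono) simp
      moreover have "2 * (484 * real n * ln (real n)) \<le> ?L * ?p * (484 * real n * ln (real n))"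
        using Lp n by (intro mult_right_mono) auto
      ultimately have "968 * (real n * ln (real n)) \<le> s\<^sup>2 * ?p"
        by (simp add: mult_ac)
      then have "121 / 72 * ln (real n) \<le> s\<^sup>2 * ?p / (576 * real n)"
        using n by (simp add: field_simps)
      then show ?thesis using n by (simp add: e_def powr_def)
    qed
    then have bad: "measure_pmf.prob (majority3_round n x) {y. \<not> biased n k (s * (1 + ?p / 6)) y} \<le> e n"
      using prob_not_biased_step[OF n(1) Suc.prems(1) s0 True] by linarith
    let ?c = "real m * e n + ((7 / 9) ^ t * real n + real (m + t) * ?r)"
    have "fail_prob n (Suc (m + t)) x \<le> e n + measure_pmf.expectation (majority3_round n x) (\<lambda>_. ?c)"
    proof (rule fail_prob_Suc_le[OF n(1) bad])
      fix y assume "y \<notin> {y. \<not> biased n k (s * (1 + ?p / 6)) y}"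
      then have "biased n k (s * (1 + ?p / 6)) y" by simp
      moreover have "22 * sqrt (?L * real n * ln (real n)) \<le> s * (1 + ?p / 6)"
        using Suc.prems(2) mult_left_mono[of 1 "1 + ?p / 6" s] s0 by simp
      moreover have "real n \<le> s * (1 + ?p / 6) * (1 + 1 / (3 * ?L)) ^ m"
        using Suc.prems(3) mult_right_mono[OF step, of "(1 + 1 / (3 * ?L)) ^ m"] L by (simp add: mult_ac)
      ultimately show "fail_prob n (m + t) y \<le> ?c" by (rule Suc.IH)
    qed (use e0 in auto)
    also have "\<dots> \<le> real (Suc m) * e n + ((7 / 9) ^ t * real n + real (Suc m + t) * ?r)"
      by (simp add: algebra_simps)
    finally show ?thesis by simp
  qed
qed

section \<open>Number of rounds and final asymptotics\<close>

lemma power_ge_of_ln: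
  fixes z N :: real
  assumes z: "0 < z" and N: "0 < N" and m: "(3 * z + 1) * ln N \<le> real m"
  shows "N \<le> (1 + 1 / (3 * z)) ^ m"
proof -
  let ?w = "1 + 1 / (3 * z)"
  have w: "0 < ?w" using z by (simp add: add_pos_pos)
  \<comment> \<open>Applying \<open>ln u \<le> u - 1\<close> to the reciprocal yields the lower
    bound \<open>1 / (3 * z + 1)\<close> on \<open>ln ?w\<close>.\<close>
  have "ln (1 / ?w) \<le> 1 / ?w - 1" using w by (intro ln_le_minus_one) simp
  also have "1 / ?w - 1 = - (1 / (3 * z + 1))" using z by (simp add: field_simps add_pos_pos)
  finally have "1 / (3 * z + 1) \<le> ln ?w" using w by (simp add: ln_div)
  then have "real m * (1 / (3 * z + 1)) \<le> real m * ln ?w" by (intro mult_left_mono) auto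
  moreover have "ln N \<le> real m * (1 / (3 * z + 1))" using m z by (simp add: field_simps)
  ultimately have "ln N \<le> ln (?w ^ m)" using w by (simp add: ln_realpow)
  then show ?thesis using w N by (simp add: ln_le_cancel_iff)
qed

text \<open>The first term dominates, with exponent 1/3 + 1 - 121/72 = -25/72 up to a logarithm, so
  1/10 leaves room. Bounding \<open>lambda_nk n k\<close> by \<open>n powr (1 / 3)\<close> makes the
  estimate uniform in \<open>k\<close>.\<close>

lemma final_asymptotics:
  "\<forall>\<^sub>F n :: nat in sequentially.
     20 * real n powr (1 / 3) * ln (real n) * (real n * real n powr (- (121 / 72)))
       + (1 / real n + 20 * real n powr (1 / 3) * ln (real n) * exp (- (real n / 189)))
     \<le> real n powr (- (1 / 10))"
  by real_asymp

text \<open>As 64 is the cube of 4, \<open>lambda_nk n k\<close> is at least 4 as soon as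
  \<open>k \<ge> 2\<close>.\<close>

lemma root_asymptotics: "\<forall>\<^sub>F n :: nat in sequentially. 64 \<le> real n / ln (real n) \<and> 1 \<le> ln (real n)"
  by (intro eventually_conj; real_asymp)


text \<open>The horizon is split into \<open>m\<close> rounds, enough for the bias to grow from 1 to
  \<open>n\<close>, and \<open>t\<close> rounds for the contraction.\<close>

lemma fail_prob_le:
  fixes n k :: nat
  defines "L \<equiv> lambda_nk n k"
  assumes l: "1 \<le> ln (real n)" and big: "64 \<le> real n / ln (real n)" and k: "2 \<le> k"
    and b: "biased n k s x" and s: "22 * sqrt (L * real n * ln (real n)) \<le> s"
  shows "fail_prob n (nat \<lfloor>20 * L * ln (real n)\<rfloor>) x
    \<le> 20 * real n powr (1 / 3) * ln (real n) * (real n * real n powr (- (121 / 72)))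
       + (1 / real n + 20 * real n powr (1 / 3) * ln (real n) * exp (- (real n / 189)))"
proof -
  define l where "l = ln (real n)"
  have n: "n > 0" using l by (cases n) auto
  have "4 \<le> root 3 (real n / l)"
    using real_root_le_mono[of 3 64 "real n / l"] big by (simp add: l_def)
  then have L4: "4 \<le> L" using k by (simp add: L_def lambda_nk_def l_def)
  have l1: "1 \<le> l" using l by (simp add: l_def)
  have "real n / l \<le> real n / 1" using l1 by (intro divide_left_mono) auto
  then have "root 3 (real n / l) \<le> root 3 (real n)" by simp
  then have Ln: "L \<le> real n powr (1 / 3)"
    using n by (simp add: L_def lambda_nk_def l_def root_powr_inverse min_le_iff_disj)
  define T where "T = nat \<lfloor>20 * L * l\<rfloor>"
  define m where "m = nat \<lceil>(3 * L + 1) * l\<rceil>"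
  have Ll: "L * l \<ge> 4 * l" "4 * l \<ge> 4" using L4 l1 by (auto intro: mult_right_mono)
  have mm: "(3 * L + 1) * l \<le> real m" "real m \<le> (3 * L + 1) * l + 1"
    using of_int_ceiling_le_add_one[of "(3 * L + 1) * l"] L4 l1
    unfolding m_def by (auto simp: real_nat_ceiling_ge)
  have TT: "real T \<le> 20 * L * l" "20 * L * l - 1 \<le> real T"
    unfolding T_def using Ll by linarith+
  \<comment> \<open>With \<open>t \<ge> 9 * l\<close> the bound
    \<open>7 / 9 \<le> exp (- (2 / 9))\<close> gives \<open>(7 / 9) ^ t \<le> 1 / n\<^sup>2\<close>,
    hence \<open>1 / n\<close> after the factor \<open>n\<close>. The rounding errors are absorbed
    by \<open>L \<ge> 4\<close> and \<open>l \<ge> 1\<close>.\<close>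
  have gap: "9 * l \<le> real T - real m"
    using mm(2) TT(2) Ll unfolding distrib_right mult.assoc by linarith
  then have mT: "m \<le> T" using l1 by linarith
  define t where "t = T - m"
  have T: "T = m + t" using mT by (simp add: t_def)
  have t9: "9 * l \<le> real t" using gap mT by (simp add: t_def of_nat_diff)
  have "1 * 1 \<le> L * (real n * l)"
    using L4 l1 n by (intro mult_mono mult_ge1_I) auto
  then have "1 \<le> sqrt (L * real n * l)" by (simp add: mult_ac)
  then have s1: "1 \<le> s" using s unfolding l_def[symmetric] by linarith
  have "real n \<le> (1 + 1 / (3 * L)) ^ m"
    using L4 n mm(1) by (intro power_ge_of_ln) (auto simp: l_def)
  also have "\<dots> \<le> s * (1 + 1 / (3 * L)) ^ m"
    using s1 L4 mult_right_mono[of 1 s "(1 + 1 / (3 * L)) ^ m"] by simp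
  finally have "fail_prob n T x \<le> real m * (real n * real n powr (- (121 / 72)))
      + ((7 / 9) ^ t * real n + real T * exp (- (real n / 189)))"
    unfolding T L_def using L4 l s
    by (intro fail_prob_biased[OF n _ _ b]) (auto simp only: L_def)
  also have "\<dots> \<le> 20 * real n powr (1 / 3) * l * (real n * real n powr (- (121 / 72)))
       + (1 / real n + 20 * real n powr (1 / 3) * l * exp (- (real n / 189)))"
  proof -
    have "20 * L * l \<le> 20 * real n powr (1 / 3) * l" using Ln L4 l1 by (intro mult_mono) auto
    then have T': "real T \<le> 20 * real n powr (1 / 3) * l" using TT(1) by linarith
    then have m': "real m \<le> 20 * real n powr (1 / 3) * l" using mT by linarith
    have "(7 / 9 :: real) \<le> exp (- (2 / 9))" using exp_ge_add_one_self[of "- (2 / 9)"] by simp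
    then have "(7 / 9 :: real) ^ t \<le> exp (- (2 / 9)) ^ t" by (intro power_mono) auto
    also have "\<dots> = exp (- (2 / 9 * real t))" by (simp add: exp_of_nat_mult[symmetric])
    also have "\<dots> \<le> exp (- l + - l)" using t9 by simp
    also have "\<dots> = 1 / real n * (1 / real n)"
      unfolding exp_add using n by (simp add: l_def exp_minus inverse_eq_divide)
    finally have "(7 / 9 :: real) ^ t * real n \<le> 1 / real n"
      using n by (simp add: field_simps)
    then show ?thesis using T' m' by (intro add_mono mult_right_mono) auto
  qed
  finally show ?thesis by (simp add: T_def l_def)
qed

theorem corollary3p2:
  shows "\<exists>(C::real) (c0::real) (n0::nat). C > 0 \<and> c0 > 0 \<and>
    (\<forall>n\<ge>n0. \<forall>(k::nat) (c :: nat \<Rightarrow> nat) (x :: nat \<Rightarrow> nat).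
       color_config n k c \<longrightarrow> colors_sorted k c \<longrightarrow>
       bias c \<ge> 22 * sqrt (lambda_nk n k * real n * ln (real n)) \<longrightarrow>
       config_of n x = c \<longrightarrow>
       measure_pmf.prob (majority3_run n (nat \<lfloor>C * lambda_nk n k * ln (real n)\<rfloor>) x)
         {ys. \<exists>y\<in>set ys. \<forall>v<n. y v = 1}
       \<ge> 1 - real n powr (- c0))"
proof -
  obtain n0 where n0: "\<And>n. n \<ge> n0 \<Longrightarrow>
      20 * real n powr (1 / 3) * ln (real n) * (real n * real n powr (- (121 / 72)))
       + (1 / real n + 20 * real n powr (1 / 3) * ln (real n) * exp (- (real n / 189)))
       \<le> real n powr (- (1 / 10))"
    "\<And>n. n \<ge> n0 \<Longrightarrow> 64 \<le> real n / ln (real n) \<and> 1 \<le> ln (real n)"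
    using eventually_conj[OF final_asymptotics root_asymptotics]
    unfolding eventually_sequentially by blast
  have "1 - real n powr (- (1 / 10)) \<le> measure_pmf.prob
      (majority3_run n (nat \<lfloor>20 * lambda_nk n k * ln (real n)\<rfloor>) x) {ys. \<exists>y\<in>set ys. \<forall>v<n. y v = 1}"
    if n: "n \<ge> n0" and c: "color_config n k c" and sorted: "colors_sorted k c"
      and bias: "bias c \<ge> 22 * sqrt (lambda_nk n k * real n * ln (real n))"
      and x: "config_of n x = c" for n k c x
  proof -
    let ?T = "nat \<lfloor>20 * lambda_nk n k * ln (real n)\<rfloor>"
    have colors: "x v \<in> {1..k}" if "v < n" for v
    proof -
      have "v \<in> {u \<in> {..<n}. x u = x v}" using that by simp
      then have "config_of n x (x v) \<noteq> 0" unfolding config_of_def by (subst card_0_eq) auto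
      then show ?thesis using c unfolding x color_config_def by metis
    qed
    have "fail_prob n ?T x \<le> real n powr (- (1 / 10))"
    proof (cases "2 \<le> k")
      case False
      \<comment> \<open>With fewer than two colors the initial state is already consensus.\<close>
      have "x v = 1" if "v < n" for v using colors[OF that] False by auto
      then show ?thesis by (simp add: fail_prob_consensus del: One_nat_def)
    next
      case True
      \<comment> \<open>By sortedness color 2 is the strongest rival, and counts vanish outside the
        color range, so \<open>bias c\<close> is a valid bound against every color.\<close>
      have "c i \<le> c 2" if "i \<noteq> 1" for i
        using c sorted True that unfolding color_config_def colors_sorted_def
        by (cases "i \<in> {1..k}") auto
      then have "biased n k (bias c) x"
        using colors unfolding biased_def bias_def x by (auto simp del: One_nat_def)
      from fail_prob_le[OF conjunct2 conjunct1 True this bias, OF n0(2)[OF n] n0(2)[OF n]] n0(1)[OF n]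
      show ?thesis by (rule order.trans)
    qed
    moreover have "measure_pmf.prob (majority3_run n ?T x) {ys. \<exists>y\<in>set ys. \<forall>v<n. y v = 1}
        = 1 - fail_prob n ?T x"
      unfolding fail_prob_def Collect_neg_eq
      using measure_pmf.prob_compl[of "{ys. \<exists>y\<in>set ys. \<forall>v<n. y v = 1}" "majority3_run n ?T x"]
      by (simp add: Compl_eq_Diff_UNIV)
    ultimately show ?thesis by linarith
  qed
  then show ?thesis
    by (intro exI[of _ "20 :: real"] exI[of _ "1 / 10 :: real"] exI[of _ n0]) auto
qed

end
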